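(* Let $X$ be a separable infinite dimensional complex Banach space, let $L(X)$ be the space of all bounded linear operators on $X$, equipped with the strong operator topology, and let $\mathcal{K}(\mathbb{D})$ be the set of all compact subsets of the closed unit disc $\mathbb{D}\subset\mathbb{C}$, equipped with the Hausdorff topology. Then the map $$\sigma : L(X) \longrightarrow \mathcal{K}(\mathbb{D}), \qquad T \longmapsto \sigma(T) = \{\lambda \in \mathbb{D} : T-\lambda I \text{ is not invertible}\}$$ is Borel.
   Context: $\mathbb{D}=\{z\in\mathbb{C}: |z|\le 1\}$ is the closed unit disc and $I$ is the identity operator on $X$. Here $\sigma(T)$ denotes the part of the usual spectrum lying in $\mathbb{D}$, i.e. $\sigma(T)=\{\lambda\in\mathbb{D}: T-\lambda I \text{ is not invertible in } L(X)\}$; it may be empty. $\mathcal{K}(\mathbb{D})$ is the set of all compact subsets of $\mathbb{D}$, including the empty set. The Hausdorff topology on $\mathcal{K}(\mathbb{D})$ is the topology generated by all sets of the form $\{F\in\mathcal{K}(\mathbb{D}): F\cap V\neq\emptyset\}$ and $\{F\in\mathcal{K}(\mathbb{D}): F\subseteq V\}$, with $V$ open in $\mathbb{D}$ (relative topology). The strong operator topology on $L(X)$ is the topology of pointwise norm convergence on $X$. A map between topological spaces is Borel if the preimage of every Borel set is a Borel set (Borel sets being the members of the $\sigma$-algebra generated by the open sets). *)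

theory Defs
  imports "HOL-Analysis.Analysis"
begin

text \<open>
  Complex normed and Banach spaces. The underlying real scalar multiplication is the
  restriction of the complex one, so norm, completeness and topology are those of the
  library classes \<^class>\<open>real_normed_vector\<close> and \<^class>\<open>banach\<close>.
\<close>

class complex_normed_vector = real_normed_vector +
  fixes scaleC :: "complex \<Rightarrow> 'a \<Rightarrow> 'a"  (infixr \<open>*\<^sub>C\<close> 75)
  assumes scaleC_add_right: "c *\<^sub>C (x + y) = c *\<^sub>C x + c *\<^sub>C y"
    and scaleC_add_left: "(c + d) *\<^sub>C x = c *\<^sub>C x + d *\<^sub>C x"
    and scaleC_scaleC: "c *\<^sub>C (d *\<^sub>C x) = (c * d) *\<^sub>C x"
    and scaleC_one: "1 *\<^sub>C x = x"
    and scaleR_scaleC: "scaleR r x = complex_of_real r *\<^sub>C x"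
    and norm_scaleC: "norm (c *\<^sub>C x) = cmod c * norm x"

class complex_banach = complex_normed_vector + banach

global_interpretation complex_vector:
  vector_space "scaleC :: complex \<Rightarrow> 'a \<Rightarrow> 'a::complex_normed_vector"
  by unfold_locales (simp_all add: scaleC_add_right scaleC_add_left scaleC_scaleC scaleC_one)

instantiation complex :: complex_banach
begin

definition scaleC_complex :: "complex \<Rightarrow> complex \<Rightarrow> complex"
  where "scaleC_complex c x = c * x"

instance
  by standard (simp_all add: scaleC_complex_def algebra_simps norm_mult scaleR_conv_of_real)

end

lemma bounded_linear_scaleC: "bounded_linear (\<lambda>x :: 'a::complex_normed_vector. c *\<^sub>C x)"
proof (rule bounded_linear_intro)
  show "c *\<^sub>C (x + y) = c *\<^sub>C x + c *\<^sub>C y" for x y :: 'a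
    by (rule scaleC_add_right)
  show "c *\<^sub>C (r *\<^sub>R x) = r *\<^sub>R (c *\<^sub>C x)" for r and x :: 'a
    by (simp add: scaleR_scaleC scaleC_scaleC mult.commute)
  show "norm (c *\<^sub>C x) \<le> norm x * cmod c" for x :: 'a
    by (simp add: norm_scaleC)
qed

lift_definition scaleC_blinfun ::
  "complex \<Rightarrow> ('a::real_normed_vector \<Rightarrow>\<^sub>L 'b::complex_normed_vector) \<Rightarrow> ('a \<Rightarrow>\<^sub>L 'b)"
  is "\<lambda>c f x. c *\<^sub>C f x"
  by (rule bounded_linear_compose[OF bounded_linear_scaleC])

text \<open>
  The library type \<open>'a \<Rightarrow>\<^sub>L 'a\<close> consists of the bounded \<^emph>\<open>real\<close>-linear operators;
  the space $L(X)$ is the subset of the complex-linear ones.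
\<close>

definition complex_operators :: "('a::complex_normed_vector \<Rightarrow>\<^sub>L 'a) set"
  where "complex_operators =
    {T. \<forall>c x. blinfun_apply T (c *\<^sub>C x) = c *\<^sub>C blinfun_apply T x}"

definition operator_SOT :: "('a::complex_normed_vector \<Rightarrow>\<^sub>L 'a) topology"
  where "operator_SOT = subtopology strong_operator_topology complex_operators"

definition invertible_operator :: "('a::complex_normed_vector \<Rightarrow>\<^sub>L 'a) \<Rightarrow> bool"
  where "invertible_operator T \<longleftrightarrow>
    (\<exists>S\<in>complex_operators. S o\<^sub>L T = id_blinfun \<and> T o\<^sub>L S = id_blinfun)"

abbreviation closed_disc :: "complex set"
  where "closed_disc \<equiv> cball 0 1"

definition disc_spectrum :: "('a::complex_normed_vector \<Rightarrow>\<^sub>L 'a) \<Rightarrow> complex set"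
  where "disc_spectrum T =
    {l \<in> closed_disc. \<not> invertible_operator (T - scaleC_blinfun l id_blinfun)}"

definition compact_subsets :: "'a::topological_space set \<Rightarrow> 'a set set"
  where "compact_subsets D = {F. compact F \<and> F \<subseteq> D}"

definition hausdorff_topology :: "'a::topological_space set \<Rightarrow> 'a set topology"
  where "hausdorff_topology D = topology_generated_by
    ({{F \<in> compact_subsets D. F \<inter> V \<noteq> {}} | V. openin (top_of_set D) V} \<union>
     {{F \<in> compact_subsets D. F \<subseteq> V} | V. openin (top_of_set D) V})"

lemma topspace_hausdorff_topology [simp]:
  "topspace (hausdorff_topology D) = compact_subsets D"
proof
  show "topspace (hausdorff_topology D) \<subseteq> compact_subsets D"
    by (auto simp: hausdorff_topology_def)
  have "compact_subsets D = {F \<in> compact_subsets D. F \<subseteq> D}"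
    by (auto simp: compact_subsets_def)
  moreover have "openin (top_of_set D) D" by simp
  ultimately show "compact_subsets D \<subseteq> topspace (hausdorff_topology D)"
    unfolding hausdorff_topology_def topology_generated_by_topspace by blast
qed

lemma topspace_operator_SOT [simp]: "topspace operator_SOT = complex_operators"
  by (simp add: operator_SOT_def strong_operator_topology_topspace)

definition borel_of :: "'a topology \<Rightarrow> 'a measure"
  where "borel_of X = sigma (topspace X) {U. openin X U}"

definition borel_map :: "'a topology \<Rightarrow> 'b topology \<Rightarrow> ('a \<Rightarrow> 'b) \<Rightarrow> bool"
  where "borel_map X Y f \<longleftrightarrow> f \<in> measurable (borel_of X) (borel_of Y)"

lemma borel_map_iff:
  "borel_map X Y f \<longleftrightarrow>
    f \<in> topspace X \<rightarrow> topspace Y \<and>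
    (\<forall>B \<in> sigma_sets (topspace Y) {U. openin Y U}.
      f -` B \<inter> topspace X \<in> sigma_sets (topspace X) {U. openin X U})"
proof -
  have sub: "{U. openin Z U} \<subseteq> Pow (topspace Z)" for Z :: "'c topology"
    by (auto dest: openin_subset)
  show ?thesis
    by (simp add: borel_map_def borel_of_def measurable_def sub space_measure_of sets_measure_of)
qed

end

theory Submission
  imports Defs
begin

text \<open>
  Fix \<open>X\<close> separable. Everything reduces to showing that, for compact \<open>K\<close> inside the disc, the set of
  operators \<open>T\<close> whose spectrum misses \<open>K\<close> is Borel. An operator is invertible iff it is bounded below
  and has dense range, so this set is the intersection of two conditions, each quantified over all
  \<open>l \<in> K\<close>, and compactness of \<open>K\<close> makes both of them Borel:

  \<^item> If every \<open>T - l\<close> with \<open>l \<in> K\<close> is invertible, then these operators share one lower bound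
    (\<open>uniformly_bounded_below_on_compact\<close>), because the lower bound persists locally. For a given
    bound \<open>c\<close>, the inequalities \<open>c * norm x \<le> norm (T x - l x)\<close> define a closed set of \<open>T\<close>, so that
    the union over \<open>c = 1 / (n + 1)\<close> is an \<open>F\<close>-sigma.

  \<^item> Approximating a fixed vector \<open>y\<close> to a fixed precision by the range of \<open>T - l\<close> is an open condition
    on the pair \<open>(T, l)\<close>, and by the tube lemma its validity for all \<open>l \<in> K\<close> is open in \<open>T\<close>
    (\<open>openin_forall_compact\<close>). Separability lets \<open>y\<close> range over a countable dense set, so the outcome
    is a \<open>G\<close>-delta.

  On the side of the target, the Hausdorff topology on the compact subsets of a second countable space
  has a countable base made of finite intersections of the conditions that \<open>F\<close> meets \<open>V\<close> or that \<open>F\<close>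
  lies in \<open>V\<close>, so only the preimages of these conditions matter (\<open>borel_map_hausdorff_topology\<close>).
  The spectrum lies in \<open>V\<close> iff it misses the compact set \<open>closed_disc - V\<close>; it meets \<open>V\<close> iff it meets one of countably many compact sets that
  exhaust the part of \<open>V\<close> inside the disc.
\<close>

section \<open>Invertibility, lower bounds and perturbation\<close>

abbreviation spectral_shift :: "('a::complex_normed_vector \<Rightarrow>\<^sub>L 'a) \<Rightarrow> complex \<Rightarrow> ('a \<Rightarrow>\<^sub>L 'a)"
  where "spectral_shift T l \<equiv> T - scaleC_blinfun l id_blinfun"

definition bounded_below :: "real \<Rightarrow> ('a::real_normed_vector \<Rightarrow>\<^sub>L 'b::real_normed_vector) \<Rightarrow> bool"
  where "bounded_below c A \<longleftrightarrow> (\<forall>x. c * norm x \<le> norm (A x))"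

lemma spectral_shift_apply: "blinfun_apply (spectral_shift T l) x = T x - l *\<^sub>C x"
  by (simp add: minus_blinfun.rep_eq scaleC_blinfun.rep_eq id_blinfun.rep_eq)

lemma spectral_shift_in_complex_operators:
  assumes "T \<in> complex_operators"
  shows "spectral_shift T l \<in> complex_operators"
proof -
  have "T (c *\<^sub>C x) - l *\<^sub>C (c *\<^sub>C x) = c *\<^sub>C (T x - l *\<^sub>C x)" for c x
  proof -
    have "l *\<^sub>C (c *\<^sub>C x) = c *\<^sub>C (l *\<^sub>C x)"
      by (metis scaleC_scaleC mult.commute)
    moreover have "T (c *\<^sub>C x) = c *\<^sub>C T x"
      using assms by (simp add: complex_operators_def)
    ultimately show ?thesis by (simp only: complex_vector.scale_right_diff_distrib)
  qed
  then show ?thesis unfolding complex_operators_def mem_Collect_eq spectral_shift_apply by blast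
qed

lemma bounded_below_inj:
  assumes "0 < c" "bounded_below c A"
  shows "inj A"
proof (rule injI)
  fix x y assume "A x = A y"
  moreover have "c * norm (x - y) \<le> norm (A (x - y))"
    using assms by (simp add: bounded_below_def)
  ultimately have "c * norm (x - y) \<le> 0" by (simp add: blinfun.diff_right)
  with \<open>0 < c\<close> show "x = y" by (simp add: mult_le_0_iff)
qed

text \<open>
  A bounded below operator on a complete space maps it onto a complete, hence closed, subspace.
\<close>

lemma bounded_below_surj_iff_dense:
  fixes A :: "'a::banach \<Rightarrow>\<^sub>L 'b::real_normed_vector"
  assumes "0 < c" "bounded_below c A"
  shows "surj A \<longleftrightarrow> closure (range A) = UNIV"
proof -
  have "complete (range A)"
    using assms
    by (intro complete_isometric_image[of c UNIV])
      (auto simp: bounded_below_def blinfun.bounded_linear_right complete_UNIV)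
  then have "closed (range A)" by (rule complete_imp_closed)
  then show ?thesis by (simp add: closure_closed)
qed

text \<open>
  A lower bound \<open>c\<close> for a bijection is the same as the bound \<open>1 / c\<close> for its inverse, and the inverse
  of a complex-linear bijection is complex-linear.
\<close>

lemma invertible_operator_iff:
  fixes A :: "'a::complex_normed_vector \<Rightarrow>\<^sub>L 'a"
  assumes A: "A \<in> complex_operators"
  shows "invertible_operator A \<longleftrightarrow> (\<exists>c>0. bounded_below c A) \<and> surj A"
proof
  assume "invertible_operator A"
  then obtain S where "S o\<^sub>L A = id_blinfun" "A o\<^sub>L S = id_blinfun"
    by (auto simp: invertible_operator_def)
  then have SA: "S (A x) = x" and AS: "A (S x) = x" for x
    by (metis blinfun_apply_blinfun_compose blinfun_apply_id_blinfun id_apply)+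
  have pos: "0 < norm S + 1"
    by (simp add: add_nonneg_pos)
  have "bounded_below (1 / (norm S + 1)) A"
    unfolding bounded_below_def
  proof
    fix x
    have "norm x \<le> norm S * norm (A x)"
      using norm_blinfun[of S "A x"] by (simp add: SA)
    also have "\<dots> \<le> (norm S + 1) * norm (A x)"
      by (simp add: mult_right_mono)
    finally show "1 / (norm S + 1) * norm x \<le> norm (A x)"
      using pos by (simp add: pos_divide_le_eq mult.commute)
  qed
  moreover have "0 < 1 / (norm S + 1)"
    using pos by simp
  moreover have "surj A" using AS by (metis surjI)
  ultimately show "(\<exists>c>0. bounded_below c A) \<and> surj A" by blast
next
  assume "(\<exists>c>0. bounded_below c A) \<and> surj A"
  then obtain c where c: "0 < c" "bounded_below c A" and "surj A" by blast
  define R where "R = inv A"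
  have AR: "A (R y) = y" for y using \<open>surj A\<close> by (simp add: R_def surj_f_inv_f)
  have RA: "R (A x) = x" for x using bounded_below_inj[OF c] by (simp add: R_def)
  have Radd: "R (x + y) = R x + R y" for x y
    by (metis AR RA blinfun.add_right)
  have RC: "R (a *\<^sub>C x) = a *\<^sub>C R x" for a x
  proof -
    have "A (a *\<^sub>C R x) = a *\<^sub>C x" using A by (simp add: complex_operators_def AR)
    then show ?thesis by (metis RA)
  qed
  have bl: "bounded_linear R"
  proof (rule bounded_linear_intro)
    show "norm (R x) \<le> norm x * (1 / c)" for x
    proof -
      have "c * norm (R x) \<le> norm (A (R x))" using c unfolding bounded_below_def by blast
      with \<open>0 < c\<close> show ?thesis by (simp add: AR field_simps)
    qed
  qed (simp_all add: Radd RC scaleR_scaleC)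
  have "Blinfun R \<in> complex_operators"
    by (simp add: complex_operators_def bounded_linear_Blinfun_apply[OF bl] RC)
  moreover have "Blinfun R o\<^sub>L A = id_blinfun" "A o\<^sub>L Blinfun R = id_blinfun"
    by (auto intro!: blinfun_eqI simp: bounded_linear_Blinfun_apply[OF bl] RA AR)
  ultimately show "invertible_operator A" unfolding invertible_operator_def by blast
qed

text \<open>
  Openness of the invertible operators, with a lower bound that is uniform near \<open>A\<close>: half of a lower
  bound for \<open>A\<close> serves both as the radius and as the lower bound of the neighbours \<open>B\<close>. Surjectivity of
  \<open>B\<close> comes from the contraction principle, since \<open>B x = y\<close> says that \<open>x\<close> is a fixed point of
  \<open>A\<close>-inverse applied to \<open>y + (A - B) x\<close>.
\<close>

lemma invertible_operator_perturbation:
  fixes A :: "'a::complex_banach \<Rightarrow>\<^sub>L 'a"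
  assumes A: "A \<in> complex_operators" and inv: "invertible_operator A"
  obtains d where "0 < d"
    "\<And>B. \<lbrakk>B \<in> complex_operators; norm (A - B) \<le> d\<rbrakk> \<Longrightarrow> bounded_below d B \<and> invertible_operator B"
proof -
  obtain c where c: "0 < c" "bounded_below c A" and "surj A"
    using inv by (auto simp: invertible_operator_iff[OF A])
  define R where "R = inv A"
  have AR: "A (R y) = y" for y using \<open>surj A\<close> by (simp add: R_def surj_f_inv_f)
  have cR: "c * norm (R y - R z) \<le> norm (y - z)" for y z
  proof -
    have "c * norm (R y - R z) \<le> norm (A (R y - R z))"
      using c unfolding bounded_below_def by blast
    then show ?thesis by (simp add: blinfun.diff_right AR)
  qed
  show thesis
  proof (rule that[of "c / 2"])
    fix B :: "'a \<Rightarrow>\<^sub>L 'a" assume B: "B \<in> complex_operators" and AB: "norm (A - B) \<le> c / 2"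
    have diff: "norm ((A - B) x) \<le> c / 2 * norm x" for x
      using norm_blinfun[of "A - B" x] mult_right_mono[OF AB norm_ge_zero[of x]] by linarith
    have bb: "bounded_below (c / 2) B"
      unfolding bounded_below_def
    proof
      fix x
      have "c * norm x \<le> norm (A x)" using c unfolding bounded_below_def by blast
      moreover have "norm (A x) \<le> norm ((A - B) x) + norm (B x)"
        by (metis blinfun.diff_left diff_add_cancel norm_triangle_ineq)
      ultimately show "c / 2 * norm x \<le> norm (B x)" using diff[of x] by linarith
    qed
    have "surj B"
      unfolding surj_def
    proof
      fix y
      let ?f = "\<lambda>x. R (y + (A - B) x)"
      have "\<exists>!x. ?f x = x"
      proof (rule banach_fix_type[of "1 / 2"])
        show "\<forall>x z. dist (?f x) (?f z) \<le> 1 / 2 * dist x z"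
        proof (intro allI)
          fix x z
          have "c * norm (?f x - ?f z) \<le> norm ((A - B) (x - z))"
            using cR[of "y + (A - B) x" "y + (A - B) z"] by (simp add: blinfun.diff_right)
          also have "\<dots> \<le> c / 2 * norm (x - z)" by (rule diff)
          finally have "c * norm (?f x - ?f z) \<le> c * (1 / 2 * norm (x - z))" by simp
          with \<open>0 < c\<close> show "dist (?f x) (?f z) \<le> 1 / 2 * dist x z"
            by (simp add: dist_norm)
        qed
      qed auto
      then obtain x where "?f x = x" by blast
      then have "A x = y + (A - B) x" by (metis AR)
      then have "y = B x" by (simp add: blinfun.diff_left)
      then show "\<exists>x. y = B x" ..
    qed
    with bb \<open>0 < c\<close> show "bounded_below (c / 2) B \<and> invertible_operator B"
      unfolding invertible_operator_iff[OF B] by (metis half_gt_zero)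
  qed (use \<open>0 < c\<close> in simp)
qed

lemma resolvent_locally_bounded_below:
  fixes T :: "'a::complex_banach \<Rightarrow>\<^sub>L 'a"
  assumes T: "T \<in> complex_operators" and inv: "invertible_operator (spectral_shift T l)"
  obtains d where "0 < d"
    "\<And>m. dist l m < d \<Longrightarrow> bounded_below d (spectral_shift T m) \<and> invertible_operator (spectral_shift T m)"
proof -
  obtain d where d: "0 < d"
    "\<And>B. \<lbrakk>B \<in> complex_operators; norm (spectral_shift T l - B) \<le> d\<rbrakk>
      \<Longrightarrow> bounded_below d B \<and> invertible_operator B"
    using invertible_operator_perturbation[OF spectral_shift_in_complex_operators[OF T] inv] by blast
  have "norm (spectral_shift T l - spectral_shift T m) \<le> dist l m" for m
  proof (rule norm_blinfun_bound)
    fix x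
    have "(spectral_shift T l - spectral_shift T m) x = (m - l) *\<^sub>C x"
      by (simp add: blinfun.diff_left scaleC_blinfun.rep_eq
          complex_vector.scale_left_diff_distrib)
    then show "norm ((spectral_shift T l - spectral_shift T m) x) \<le> dist l m * norm x"
      by (simp add: norm_scaleC dist_norm norm_minus_commute)
  qed simp
  then show thesis
    using d spectral_shift_in_complex_operators[OF T]
    by (intro that[of d]) (meson less_imp_le order_trans)+
qed

text \<open>
  Finitely many of the local lower bounds cover \<open>K\<close>, and their minimum is a common one.
\<close>

lemma uniformly_bounded_below_on_compact:
  fixes T :: "'a::complex_banach \<Rightarrow>\<^sub>L 'a"
  assumes T: "T \<in> complex_operators" and "compact K"
    and inv: "\<And>l. l \<in> K \<Longrightarrow> invertible_operator (spectral_shift T l)"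
  obtains c where "0 < c" "\<And>l. l \<in> K \<Longrightarrow> bounded_below c (spectral_shift T l)"
proof -
  have "\<forall>l\<in>K. \<exists>d>0. \<forall>m. dist l m < d \<longrightarrow> bounded_below d (spectral_shift T m)"
    using resolvent_locally_bounded_below[OF T inv] by metis
  then obtain d where d: "\<And>l. l \<in> K \<Longrightarrow> 0 < d l"
    "\<And>l m. l \<in> K \<Longrightarrow> dist l m < d l \<Longrightarrow> bounded_below (d l) (spectral_shift T m)"
    by metis
  have "K \<subseteq> (\<Union>l\<in>K. ball l (d l))" using d(1) by force
  then obtain L where L: "L \<subseteq> K" "finite L" "K \<subseteq> (\<Union>l\<in>L. ball l (d l))"
    using compactE_image[OF \<open>compact K\<close>, of K "\<lambda>l. ball l (d l)"] by auto
  define c where "c = Min (insert 1 (d ` L))"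
  have "0 < c" unfolding c_def using L d(1) by (subst Min_gr_iff) auto
  moreover have "bounded_below c (spectral_shift T m)" if "m \<in> K" for m
  proof -
    have "m \<in> (\<Union>l\<in>L. ball l (d l))" using L(3) that by blast
    then obtain l where l: "l \<in> L" "dist l m < d l" by auto
    then have "bounded_below (d l) (spectral_shift T m)" using d L by blast
    moreover have "c \<le> d l" unfolding c_def using l L by (intro Min_le) auto
    ultimately show ?thesis
      unfolding bounded_below_def by (meson mult_right_mono norm_ge_zero order_trans)
  qed
  ultimately show thesis using that by blast
qed

text \<open>
  The spectrum is closed in the disc because the resolvent set is open; this is what makes the spectrum
  a point of the hyperspace.
\<close>

lemma compact_disc_spectrum:
  fixes T :: "'a::complex_banach \<Rightarrow>\<^sub>L 'a"
  assumes T: "T \<in> complex_operators"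
  shows "compact (disc_spectrum T)"
proof -
  have "open {l. invertible_operator (spectral_shift T l)}"
    unfolding open_dist
    using resolvent_locally_bounded_below[OF T] by (metis dist_commute mem_Collect_eq)
  then have "compact (closed_disc \<inter> - {l. invertible_operator (spectral_shift T l)})"
    by (intro compact_Int_closed) (auto simp: closed_Compl)
  also have "closed_disc \<inter> - {l. invertible_operator (spectral_shift T l)} = disc_spectrum T"
    by (auto simp: disc_spectrum_def)
  finally show ?thesis .
qed

section \<open>Borel maps into the hyperspace of compact sets\<close>

lemma borel_of_openin: "openin X U \<Longrightarrow> U \<in> sets (borel_of X)"
  unfolding borel_of_def by (subst sets_measure_of) (auto dest: openin_subset)

lemma space_borel_of [simp]: "space (borel_of X) = topspace X"
  unfolding borel_of_def by (subst space_measure_of) (auto dest: openin_subset)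

lemma borel_of_closedin: "closedin X C \<Longrightarrow> C \<in> sets (borel_of X)"
  by (metis borel_of_openin closedin_def double_diff sets.compl_sets space_borel_of subset_refl)

text \<open>
  Preimages of generating sets do not suffice for an arbitrary subbase, as an open set may need
  uncountable unions. If a countable family \<open>\<N>\<close> refines the subbase pointwise, then the finite
  intersections from \<open>\<N>\<close> exhaust every open set from within, and there are only countably many of
  them. The members of \<open>\<N>\<close> themselves may be arbitrary sets, which allows ambient open sets to be
  used in place of relatively open ones.
\<close>

lemma borel_map_topology_generated_by:
  assumes f: "f \<in> topspace X \<rightarrow> \<Union>\<S>" and "countable \<N>"
    and refine: "\<And>A p. \<lbrakk>A \<in> \<S>; p \<in> A\<rbrakk> \<Longrightarrow> \<exists>B\<in>\<N>. p \<in> B \<and> B \<subseteq> A"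
    and preimage: "\<And>B. B \<in> \<N> \<Longrightarrow> f -` B \<inter> topspace X \<in> sets (borel_of X)"
  shows "borel_map X (topology_generated_by \<S>) f"
proof -
  define \<C> where "\<C> = Inter ` {\<A>. finite \<A> \<and> \<A> \<subseteq> \<N>}"
  have "countable \<C>"
    unfolding \<C>_def using \<open>countable \<N>\<close> by (intro countable_image countable_Collect_finite_subset)
  have \<C>E: "\<exists>\<A>. finite \<A> \<and> \<A> \<subseteq> \<N> \<and> C = \<Inter>\<A>" if "C \<in> \<C>" for C
    using that unfolding \<C>_def by (elim imageE CollectE conjE) (intro exI conjI)
  have \<C>I: "\<Inter>\<A> \<in> \<C>" if "finite \<A>" "\<A> \<subseteq> \<N>" for \<A>
    using that unfolding \<C>_def by (intro imageI CollectI conjI)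
  have preimage_\<C>: "f -` C \<inter> topspace X \<in> sets (borel_of X)" if C: "C \<in> \<C>" for C
  proof -
    obtain \<A> where \<A>: "finite \<A>" "\<A> \<subseteq> \<N>" "C = \<Inter>\<A>"
      using \<C>E[OF C] by metis
    have "{x \<in> space (borel_of X). \<forall>A\<in>\<A>. f x \<in> A} \<in> sets (borel_of X)"
    proof (intro sets.sets_Collect_finite_All)
      fix A assume "A \<in> \<A>"
      then have "f -` A \<inter> topspace X \<in> sets (borel_of X)" using \<A> preimage by blast
      then show "{x \<in> space (borel_of X). f x \<in> A} \<in> sets (borel_of X)"
        by (rule back_subst[of "\<lambda>U. U \<in> sets (borel_of X)"]) auto
    qed (rule \<A>(1))
    then show ?thesis
      by (rule back_subst[of "\<lambda>U. U \<in> sets (borel_of X)"]) (auto simp: \<A>(3))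
  qed
  have base: "\<forall>p\<in>U. \<exists>C\<in>\<C>. p \<in> C \<and> C \<subseteq> U" if "generate_topology_on \<S> U" for U
    using that
  proof induction
    case (Int U V)
    show ?case
    proof
      fix p assume "p \<in> U \<inter> V"
      then obtain C D where CD: "C \<in> \<C>" "p \<in> C" "C \<subseteq> U" "D \<in> \<C>" "p \<in> D" "D \<subseteq> V"
        using Int.IH by (metis IntE)
      obtain \<A> \<B> where AB: "finite \<A>" "\<A> \<subseteq> \<N>" "C = \<Inter>\<A>" "finite \<B>" "\<B> \<subseteq> \<N>" "D = \<Inter>\<B>"
        using \<C>E[OF CD(1)] \<C>E[OF CD(4)] by metis
      have "C \<inter> D \<in> \<C>"
        using \<C>I[of "\<A> \<union> \<B>"] AB by (simp add: Inter_Un_distrib)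
      with CD show "\<exists>C\<in>\<C>. p \<in> C \<and> C \<subseteq> U \<inter> V"
        by (intro bexI[of _ "C \<inter> D"]) auto
    qed
  next
    case (Basis A)
    show ?case
    proof
      fix p assume "p \<in> A"
      then obtain B where "B \<in> \<N>" "p \<in> B" "B \<subseteq> A" using refine[OF Basis] by metis
      with \<C>I[of "{B}"] show "\<exists>C\<in>\<C>. p \<in> C \<and> C \<subseteq> A"
        by (intro bexI[of _ B]) simp_all
    qed
  next
    case (UN K)
    show ?case
    proof
      fix p assume "p \<in> \<Union>K"
      then obtain k where "k \<in> K" "p \<in> k" by (rule UnionE)
      moreover from this obtain C where "C \<in> \<C>" "p \<in> C" "C \<subseteq> k" using UN.IH by metis
      ultimately show "\<exists>C\<in>\<C>. p \<in> C \<and> C \<subseteq> \<Union>K"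
        by (intro bexI[of _ C]) auto
    qed
  qed simp
  show ?thesis
    unfolding borel_map_def borel_of_def[of "topology_generated_by \<S>"]
  proof (rule measurable_measure_of)
    fix U assume "U \<in> {U. openin (topology_generated_by \<S>) U}"
    then have "\<forall>p\<in>U. \<exists>C\<in>\<C>. p \<in> C \<and> C \<subseteq> U"
      using base by (simp add: openin_topology_generated_by_iff)
    then have "f -` U \<inter> space (borel_of X) = (\<Union>C\<in>{C \<in> \<C>. C \<subseteq> U}. f -` C \<inter> topspace X)"
      unfolding space_borel_of by blast
    also have "\<dots> \<in> sets (borel_of X)"
      using \<open>countable \<C>\<close> preimage_\<C> by (intro sets.countable_UN') auto
    finally show "f -` U \<inter> space (borel_of X) \<in> sets (borel_of X)" .
  next
    show "{U. openin (topology_generated_by \<S>) U} \<subseteq> Pow (topspace (topology_generated_by \<S>))"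
      using openin_subset by blast
  qed (use f in simp)
qed

text \<open>
  The countable refinement comes from a countable base of the ambient space: if \<open>F\<close> meets \<open>V\<close>, then it
  meets a basic set inside \<open>V\<close>, and if \<open>F\<close> lies in \<open>V\<close>, then by compactness it lies in a finite union
  of basic sets inside \<open>V\<close>.
\<close>

lemma borel_map_hausdorff_topology:
  fixes f :: "'x \<Rightarrow> 'a::second_countable_topology set"
  assumes f: "f \<in> topspace X \<rightarrow> compact_subsets D"
    and hit: "\<And>V. open V \<Longrightarrow> {x \<in> topspace X. f x \<inter> V \<noteq> {}} \<in> sets (borel_of X)"
    and inside: "\<And>V. open V \<Longrightarrow> {x \<in> topspace X. f x \<subseteq> V} \<in> sets (borel_of X)"
  shows "borel_map X (hausdorff_topology D) f"
proof -
  obtain \<B> :: "'a set set" where \<B>: "countable \<B>" "topological_basis \<B>"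
    using ex_countable_basis by blast
  define \<N> where "\<N> = (\<lambda>V. {F \<in> compact_subsets D. F \<inter> V \<noteq> {}}) ` \<B> \<union>
      (\<lambda>\<V>. {F \<in> compact_subsets D. F \<subseteq> \<Union>\<V>}) ` {\<V>. finite \<V> \<and> \<V> \<subseteq> \<B>}"
  show ?thesis
    unfolding hausdorff_topology_def
  proof (rule borel_map_topology_generated_by[of _ _ _ \<N>])
    show "f \<in> topspace X \<rightarrow> \<Union> ({{F \<in> compact_subsets D. F \<inter> V \<noteq> {}} | V. openin (top_of_set D) V} \<union>
     {{F \<in> compact_subsets D. F \<subseteq> V} | V. openin (top_of_set D) V})"
      using f topspace_hausdorff_topology[of D]
      unfolding hausdorff_topology_def topology_generated_by_topspace by simp
    show "countable \<N>"
      unfolding \<N>_def using \<B>(1)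
      by (intro countable_Un countable_image countable_Collect_finite_subset)
  next
    fix A F
    assume "A \<in> {{F \<in> compact_subsets D. F \<inter> V \<noteq> {}} | V. openin (top_of_set D) V} \<union>
     {{F \<in> compact_subsets D. F \<subseteq> V} | V. openin (top_of_set D) V}" and "F \<in> A"
    then consider
      (hit) V where "openin (top_of_set D) V" "A = {F \<in> compact_subsets D. F \<inter> V \<noteq> {}}"
      | (inside) V where "openin (top_of_set D) V" "A = {F \<in> compact_subsets D. F \<subseteq> V}"
      by blast
    then show "\<exists>B\<in>\<N>. F \<in> B \<and> B \<subseteq> A"
    proof cases
      case hit
      obtain W where W: "open W" "V = D \<inter> W"
        using hit(1) unfolding openin_open by blast
      obtain p where p: "p \<in> F" "p \<in> W" using hit W \<open>F \<in> A\<close> by auto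
      then obtain U where U: "U \<in> \<B>" "p \<in> U" "U \<subseteq> W"
        using topological_basisE[OF \<B>(2) W(1)] by blast
      let ?B = "{F \<in> compact_subsets D. F \<inter> U \<noteq> {}}"
      have "?B \<in> \<N>" using U by (auto simp: \<N>_def)
      moreover have "F \<in> ?B" using hit p U \<open>F \<in> A\<close> by auto
      moreover have "?B \<subseteq> A" using hit W U by (auto simp: compact_subsets_def)
      ultimately show ?thesis by (intro bexI[of _ ?B] conjI)
    next
      case inside
      obtain W where W: "open W" "V = D \<inter> W"
        using inside(1) unfolding openin_open by blast
      have F: "compact F" "F \<subseteq> D" "F \<subseteq> W" using inside W \<open>F \<in> A\<close> by (auto simp: compact_subsets_def)
      obtain \<W> where \<W>: "\<W> \<subseteq> \<B>" "\<Union>\<W> = W"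
        using \<B>(2) W(1) unfolding topological_basis_def by blast
      obtain \<V> where \<V>: "\<V> \<subseteq> \<W>" "finite \<V>" "F \<subseteq> \<Union>\<V>"
        using compactE[OF F(1), of \<W>] F(3) \<W> topological_basis_open[OF \<B>(2)] by (metis subsetD)
      let ?B = "{F \<in> compact_subsets D. F \<subseteq> \<Union>\<V>}"
      have "?B \<in> \<N>" using \<V> \<W> by (auto simp: \<N>_def)
      moreover have "F \<in> ?B" using \<V> F by (auto simp: compact_subsets_def)
      moreover have "?B \<subseteq> A" 
        unfolding inside(2) W(2) using Union_mono[OF \<V>(1)]
        unfolding \<W>(2) compact_subsets_def by blast
      ultimately show ?thesis by (intro bexI[of _ ?B] conjI)
    qed
  next
    fix B assume "B \<in> \<N>"
    then consider (hit) V where "V \<in> \<B>" "B = {F \<in> compact_subsets D. F \<inter> V \<noteq> {}}"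
      | (inside) \<V> where "\<V> \<subseteq> \<B>" "B = {F \<in> compact_subsets D. F \<subseteq> \<Union>\<V>}"
      by (auto simp: \<N>_def)
    then show "f -` B \<inter> topspace X \<in> sets (borel_of X)"
    proof cases
      case hit
      then have "f -` B \<inter> topspace X = {x \<in> topspace X. f x \<inter> V \<noteq> {}}" using f by auto
      then show ?thesis using assms(2) hit(1) topological_basis_open[OF \<B>(2)] by simp
    next
      case inside
      then have "f -` B \<inter> topspace X = {x \<in> topspace X. f x \<subseteq> \<Union>\<V>}" using f by auto
      moreover have "open (\<Union>\<V>)"
        using inside \<B>(2) by (intro open_Union) (auto simp: topological_basis_open)
      ultimately show ?thesis using assms(3) by simp
    qed
  qed
qed

section \<open>Borel sets of operators determined by a compact set of parameters\<close>

text \<open>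
  The tube lemma: projection along a compact factor is a closed map, so it sends the complement of \<open>W\<close>
  to a closed set.
\<close>

lemma openin_forall_compact:
  fixes K :: "'b::topological_space set"
  assumes "compact K" and W: "openin (prod_topology X (top_of_set K)) W"
  shows "openin X {T \<in> topspace X. \<forall>l\<in>K. (T, l) \<in> W}"
proof -
  let ?P = "prod_topology X (top_of_set K)"
  have "closed_map ?P X fst"
    using \<open>compact K\<close>
    by (intro Abstract_Topological_Spaces.closed_map_fst) (simp add: compact_space_subtopology)
  moreover have "closedin ?P (topspace ?P - W)"
    using W by (intro closedin_diff closedin_topspace)
  ultimately have "closedin X (fst ` (topspace ?P - W))"
    unfolding closed_map_def by blast
  moreover have "topspace X - fst ` (topspace ?P - W) = {T \<in> topspace X. \<forall>l\<in>K. (T, l) \<in> W}"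
    by (force simp: image_iff)
  ultimately show ?thesis by (metis openin_diff openin_topspace)
qed

text \<open>
  Applied to a fixed vector, the shift is a difference of an evaluation of the operator, continuous by
  the choice of the strong topology, and a multiple of that vector, continuous in the scalar.
\<close>

lemma continuous_map_spectral_shift:
  fixes x :: "'a::complex_normed_vector"
  shows "continuous_map (prod_topology operator_SOT (top_of_set K)) euclidean
    (\<lambda>p. spectral_shift (fst p) (snd p) x)"
proof -
  have "continuous_map (prod_topology operator_SOT (top_of_set K)) euclidean
      ((\<lambda>T. blinfun_apply T x) \<circ> fst)"
    by (intro continuous_map_compose[OF continuous_map_fst])
      (simp add: operator_SOT_def continuous_map_from_subtopology
        strong_operator_topology_continuous_evaluation)
  moreover have "bounded_linear (\<lambda>l. l *\<^sub>C x)"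
  proof (rule bounded_linear_intro)
    show "(r *\<^sub>R l) *\<^sub>C x = r *\<^sub>R (l *\<^sub>C x)" for r l
      by (simp add: scaleR_scaleC[of r "l *\<^sub>C x"] scaleC_scaleC scaleR_conv_of_real)
    show "norm (l *\<^sub>C x) \<le> norm l * norm x" for l
      by (simp add: norm_scaleC)
  qed (rule scaleC_add_left)
  then have "continuous_on K (\<lambda>l. l *\<^sub>C x)"
    by (rule linear_continuous_on)
  then have "continuous_map (prod_topology operator_SOT (top_of_set K)) euclidean
      ((\<lambda>l. l *\<^sub>C x) \<circ> snd)"
    by (intro continuous_map_compose[OF continuous_map_snd]) simp
  ultimately show ?thesis
    unfolding spectral_shift_apply o_def by (rule continuous_map_diff)
qed

lemma openin_norm_spectral_shift_less:
  fixes x y :: "'a::complex_normed_vector"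
  shows "openin (prod_topology operator_SOT (top_of_set K))
    {p \<in> complex_operators \<times> K. norm (spectral_shift (fst p) (snd p) x - y) < e}"
proof -
  have "continuous_map (prod_topology operator_SOT (top_of_set K)) euclidean
      (\<lambda>p. norm (spectral_shift (fst p) (snd p) x - y))"
    by (intro continuous_map_norm continuous_map_diff continuous_map_spectral_shift) simp
  from openin_continuous_map_preimage[OF this, of "{..<e}"] show ?thesis
    by simp
qed

text \<open>
  For a fixed \<open>x\<close> the condition on \<open>(T, l)\<close> is open; the approximating \<open>x\<close> depends on \<open>l\<close>, so the
  union over \<open>x\<close> is formed before the tube lemma is applied.
\<close>

lemma openin_dense_range_on_compact:
  fixes y :: "'a::complex_normed_vector"
  assumes "compact K"
  shows "openin operator_SOT
    {T \<in> complex_operators. \<forall>l\<in>K. \<exists>x. norm (spectral_shift T l x - y) < e}"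
proof -
  let ?W = "\<Union>x. {p \<in> complex_operators \<times> K. norm (spectral_shift (fst p) (snd p) x - y) < e}"
  have "openin (prod_topology operator_SOT (top_of_set K)) ?W"
    by (intro openin_Union) (auto simp: openin_norm_spectral_shift_less)
  from openin_forall_compact[OF assms this] show ?thesis
    by (rule back_subst[of "openin operator_SOT"]) auto
qed

text \<open>
  With the constant fixed, this is an intersection of closed conditions over \<open>l\<close> and \<open>x\<close>, no matter how
  many there are. The complement is used in the proof so that \<open>K\<close> may be empty.
\<close>

lemma closedin_bounded_below_on:
  "closedin operator_SOT
    {T \<in> complex_operators. \<forall>l\<in>K. bounded_below c (spectral_shift T l)}"
proof -
  have "openin operator_SOT
      {T \<in> complex_operators. norm (spectral_shift T l x - 0) < c * norm x}" for l and x :: 'a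
    using openin_forall_compact[OF compact_sing openin_norm_spectral_shift_less[of "{l}" x 0 "c * norm x"]]
    by (rule back_subst[of "openin operator_SOT"]) auto
  then have "openin operator_SOT (\<Union>l\<in>K. \<Union>x.
      {T \<in> complex_operators. norm (spectral_shift T l (x::'a) - 0) < c * norm x})"
    by (intro openin_Union) auto
  from closedin_diff[OF closedin_topspace this]
  have "closedin operator_SOT (complex_operators - (\<Union>l\<in>K. \<Union>x.
      {T \<in> complex_operators. norm (spectral_shift T l (x::'a) - 0) < c * norm x}))"
    by (simp only: topspace_operator_SOT)
  then show ?thesis
    by (rule back_subst[of "closedin operator_SOT"]) (fastforce simp: bounded_below_def not_less[symmetric])
qed

text \<open>
  The description of invertibility along \<open>K\<close> in which every quantifier outside a closed or an open
  condition is countable once \<open>D\<close> is. The left to right direction needs the uniform lower bound in order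
  to pull \<open>n\<close> in front of \<open>l\<close>.
\<close>

lemma invertible_on_compact_iff:
  fixes T :: "'a::complex_banach \<Rightarrow>\<^sub>L 'a"
  assumes T: "T \<in> complex_operators" and "compact K" and D: "closure D = (UNIV :: 'a set)"
  shows "(\<forall>l\<in>K. invertible_operator (spectral_shift T l)) \<longleftrightarrow>
    (\<exists>n. \<forall>l\<in>K. bounded_below (1 / real (Suc n)) (spectral_shift T l)) \<and>
    (\<forall>y\<in>D. \<forall>n. \<forall>l\<in>K. \<exists>x. norm (spectral_shift T l x - y) < 1 / real (Suc n))"
    (is "?inv \<longleftrightarrow> ?below \<and> ?dense")
proof
  assume inv: ?inv
  then obtain c where c: "0 < c" "\<And>l. l \<in> K \<Longrightarrow> bounded_below c (spectral_shift T l)"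
    using uniformly_bounded_below_on_compact[OF T \<open>compact K\<close>] by blast
  obtain n where "1 / real (Suc n) < c"
    using c(1) nat_approx_posE by blast
  then have ?below
    using c(2) unfolding bounded_below_def
    by (meson less_imp_le mult_right_mono norm_ge_zero order_trans)
  moreover have ?dense
  proof (intro ballI allI)
    fix y n l assume "l \<in> K"
    then have "surj (spectral_shift T l)"
      using inv invertible_operator_iff[OF spectral_shift_in_complex_operators[OF T]] by blast
    then obtain x where "spectral_shift T l x = y" by (metis surjD)
    then show "\<exists>x. norm (spectral_shift T l x - y) < 1 / real (Suc n)"
      by (intro exI[of _ x]) simp
  qed
  ultimately show "?below \<and> ?dense" ..
next
  assume *: "?below \<and> ?dense"
  then obtain n where n: "\<And>l. l \<in> K \<Longrightarrow> bounded_below (1 / real (Suc n)) (spectral_shift T l)"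
    by blast
  show ?inv
  proof
    fix l assume l: "l \<in> K"
    have "D \<subseteq> closure (range (spectral_shift T l))"
    proof
      fix y assume y: "y \<in> D"
      show "y \<in> closure (range (spectral_shift T l))"
        unfolding closure_approachable
      proof (intro allI impI)
        fix e :: real assume "0 < e"
        then obtain k where k: "1 / real (Suc k) < e" using nat_approx_posE by blast
        obtain x where "norm (spectral_shift T l x - y) < 1 / real (Suc k)"
          using * l y by blast
        with k show "\<exists>z\<in>range (spectral_shift T l). dist z y < e"
          by (intro bexI[of _ "spectral_shift T l x"]) (simp_all add: dist_norm)
      qed
    qed
    then have "closure D \<subseteq> closure (range (spectral_shift T l))"
      by (simp add: closure_minimal)
    then have "surj (spectral_shift T l)"
      using D bounded_below_surj_iff_dense[OF _ n[OF l]] by auto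
    then show "invertible_operator (spectral_shift T l)"
      unfolding invertible_operator_iff[OF spectral_shift_in_complex_operators[OF T]]
      using n[OF l] by (intro conjI exI[of _ "1 / real (Suc n)"]) auto
  qed
qed

lemma borel_disc_spectrum_disjoint_compact:
  fixes K :: "complex set"
  assumes separable: "separable_space (euclidean :: 'a::complex_banach topology)"
    and K: "compact K" "K \<subseteq> closed_disc"
  shows "{T \<in> complex_operators :: ('a \<Rightarrow>\<^sub>L 'a) set. disc_spectrum T \<inter> K = {}}
    \<in> sets (borel_of operator_SOT)"
proof -
  let ?M = "borel_of (operator_SOT :: ('a \<Rightarrow>\<^sub>L 'a) topology)"
  obtain D :: "'a set" where D: "countable D" "closure D = UNIV"
    using separable by (auto simp: separable_space_def)
  have "{T \<in> complex_operators :: ('a \<Rightarrow>\<^sub>L 'a) set. disc_spectrum T \<inter> K = {}} =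
      {T \<in> space ?M. (\<exists>n. \<forall>l\<in>K. bounded_below (1 / real (Suc n)) (spectral_shift T l)) \<and>
        (\<forall>y\<in>D. \<forall>n. \<forall>l\<in>K. \<exists>x. norm (spectral_shift T l x - y) < 1 / real (Suc n))}"
  proof (rule Collect_cong)
    fix T :: "'a \<Rightarrow>\<^sub>L 'a"
    have "disc_spectrum T \<inter> K = {} \<longleftrightarrow> (\<forall>l\<in>K. invertible_operator (spectral_shift T l))"
      unfolding disc_spectrum_def disjoint_iff mem_Collect_eq using K(2) by blast
    then show "(T \<in> complex_operators \<and> disc_spectrum T \<inter> K = {}) \<longleftrightarrow>
      T \<in> space ?M \<and> (\<exists>n. \<forall>l\<in>K. bounded_below (1 / real (Suc n)) (spectral_shift T l)) \<and>
        (\<forall>y\<in>D. \<forall>n. \<forall>l\<in>K. \<exists>x. norm (spectral_shift T l x - y) < 1 / real (Suc n))"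
      using invertible_on_compact_iff[OF _ K(1) D(2), of T]
      unfolding space_borel_of topspace_operator_SOT by blast
  qed
  also have "\<dots> \<in> sets ?M"
  proof (intro sets.sets_Collect_conj)
    have "{T \<in> space ?M. \<forall>l\<in>K. bounded_below (1 / real (Suc n)) (spectral_shift T l)} \<in> sets ?M" for n
      using borel_of_closedin[OF closedin_bounded_below_on] by simp
    then show "{T \<in> space ?M. \<exists>n. \<forall>l\<in>K. bounded_below (1 / real (Suc n)) (spectral_shift T l)}
        \<in> sets ?M"
      by (rule sets.sets_Collect_countable_Ex)
    have "{T \<in> space ?M. \<forall>l\<in>K. \<exists>x. norm (spectral_shift T l x - y) < 1 / real (Suc n)} \<in> sets ?M"
      for y n
      using borel_of_openin[OF openin_dense_range_on_compact[OF K(1)]] by simp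
    then have "{T \<in> space ?M. \<forall>n. \<forall>l\<in>K. \<exists>x. norm (spectral_shift T l x - y) < 1 / real (Suc n)}
        \<in> sets ?M" for y
      by (rule sets.sets_Collect_countable_All)
    then show "{T \<in> space ?M. \<forall>y\<in>D. \<forall>n. \<forall>l\<in>K.
        \<exists>x. norm (spectral_shift T l x - y) < 1 / real (Suc n)} \<in> sets ?M"
      using D(1) by (intro sets.sets_Collect_countable_All')
  qed
  finally show ?thesis .
qed

theorem theorem3p1:
  assumes separable: "separable_space (euclidean :: 'a::complex_banach topology)"
    and infinite_dim: "\<not> (\<exists>B :: 'a set. finite B \<and> complex_vector.span B = UNIV)"
  shows "borel_map (operator_SOT :: ('a \<Rightarrow>\<^sub>L 'a) topology) (hausdorff_topology closed_disc)
           disc_spectrum"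
proof (rule borel_map_hausdorff_topology)
  let ?M = "borel_of (operator_SOT :: ('a \<Rightarrow>\<^sub>L 'a) topology)"
  have disc: "disc_spectrum T \<subseteq> closed_disc" for T :: "'a \<Rightarrow>\<^sub>L 'a"
    by (auto simp: disc_spectrum_def)
  show "disc_spectrum \<in> topspace (operator_SOT :: ('a \<Rightarrow>\<^sub>L 'a) topology) \<rightarrow> compact_subsets closed_disc"
    using disc by (auto simp: compact_subsets_def compact_disc_spectrum)
  fix V :: "complex set" assume V: "open V"
  have "compact (closed_disc - V)" using V by (simp add: compact_diff)
  from borel_disc_spectrum_disjoint_compact[OF separable this]
  show "{T \<in> topspace operator_SOT :: ('a \<Rightarrow>\<^sub>L 'a) set. disc_spectrum T \<subseteq> V} \<in> sets ?M"
    by (rule back_subst[of "\<lambda>U. U \<in> sets ?M"]) (use disc in auto)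
  \<comment> \<open>An open subset of the plane is a countable union of compact sets, so meeting \<open>V\<close> becomes a
      countable union of conditions of the kind already treated.\<close>
  obtain C where C: "\<And>n::nat. compact (C n)" "\<Union>(range C) = V"
    using open_Union_compact_subsets[OF V] by metis
  have "{T \<in> complex_operators :: ('a \<Rightarrow>\<^sub>L 'a) set. disc_spectrum T \<inter> (closed_disc \<inter> C n) = {}} \<in> sets ?M" for n
    using C(1) by (intro borel_disc_spectrum_disjoint_compact[OF separable]) (auto intro: compact_Int)
  then have "space ?M - (\<Inter>n. {T \<in> complex_operators. disc_spectrum T \<inter> (closed_disc \<inter> C n) = {}}) \<in> sets ?M"
    by (intro sets.compl_sets sets.countable_INT) auto
  then show "{T \<in> topspace operator_SOT :: ('a \<Rightarrow>\<^sub>L 'a) set. disc_spectrum T \<inter> V \<noteq> {}} \<in> sets ?M"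
    by (rule back_subst[of "\<lambda>U. U \<in> sets ?M"]) (use disc C(2) in fastforce)
qed

end
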